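(* Let $G=(V,E)$ be a connected finite graph with positive symmetric edge weights $w_{xy}$ and a measure $\mu:V\to\mathbb{R}^{+}$, and let $h:V\to\mathbb{R}$ be a positive function. Let $$\mathbf{H}=\left\{u\in \mathbf{W}^{1,2}(V)\;\Big|\;\int_V u\,d\mu=0\right\},\qquad J_{\alpha,\beta}(u)=\frac12\int_V\left(|\nabla u|^2-\alpha u^2\right)d\mu-\beta\log\int_V he^u\,d\mu .$$ Let $\lambda_1(V)<\lambda_2(V)<\cdots<\lambda_{m-1}(V)$ be all the distinct non-zero eigenvalues of $-\Delta$, let $E_{\lambda_s(V)}$ be the eigenspace of $\lambda_s(V)$ with orthonormal basis $\{u_{si}\}_{i=1}^{n_s}$, and let $k\ge1$ be an integer with $k+1\le m-1$. For $j\in\{k,k+1\}$ put $E_j=E_{\lambda_1(V)}\oplus\cdots\oplus E_{\lambda_j(V)}$ and $E_j^{\perp}=\{u\in\mathbf{H}\mid\int_V uv\,d\mu=0\ \ \forall v\in E_j\}$. Then: (i) If $\alpha>\lambda_{k+1}(V)$, then for any $\beta\in\mathbb{R}$, $\inf_{u\in E_k^{\perp}}J_{\alpha,\beta}(u)=-\infty$. (ii) If $\alpha=\lambda_{k+1}(V)$, then: (ii-a) for any $\beta>0$, $\inf_{u\in E_k^{\perp}}J_{\lambda_{k+1}(V),\beta}(u)=-\infty$; (ii-b) $J_{\lambda_{k+1}(V),0}$ has a minimizer in $E_k^{\perp}$ (i.e. attains its infimum over $E_k^{\perp}$), so that the Kazdan-Warner equation $$\Delta u+\alpha u=-\frac{\beta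 he^{u}}{\int_V he^{u}\,d\mu}+\frac{\beta}{\mathrm{Vol}(V)}+\sum_{s=1}^{k}\sum_{i=1}^{n_s}\frac{\beta\int_V hu_{si}e^{u}\,d\mu}{\int_V he^{u}\,d\mu}\,u_{si}\quad\text{on }V$$ with $\alpha=\lambda_{k+1}(V)$ and $\beta=0$ has a solution $u\in E_k^{\perp}$; (ii-c) for any $\beta<0$, $J_{\lambda_{k+1}(V),\beta}$ has a minimizer in $E_{k+1}^{\perp}$ (i.e. attains its infimum over $E_{k+1}^{\perp}$), so that the Kazdan-Warner equation $$\Delta u+\alpha u=-\frac{\beta he^{u}}{\int_V he^{u}\,d\mu}+\frac{\beta}{\mathrm{Vol}(V)}+\sum_{s=1}^{k+1}\sum_{i=1}^{n_s}\frac{\beta\int_V hu_{si}e^{u}\,d\mu}{\int_V he^{u}\,d\mu}\,u_{si}\quad\text{on }V$$ with $\alpha=\lambda_{k+1}(V)$ has a solution $u\in E_{k+1}^{\perp}$.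
   Context: $G=(V,E)$ is a finite connected graph; each edge $xy\in E$ has a weight $w_{xy}>0$ with $w_{xy}=w_{yx}$; $y\sim x$ means $xy\in E$; $\mu:V\to\mathbb{R}^{+}$ is a positive finite measure. For $u:V\to\mathbb{R}$, $$\Delta u(x)=\frac{1}{\mu(x)}\sum_{y\sim x}w_{xy}[u(y)-u(x)],\qquad |\nabla u|(x)=\left\{\frac{1}{2\mu(x)}\sum_{y\sim x}w_{xy}[u(y)-u(x)]^2\right\}^{1/2}.$$ For $g:V\to\mathbb{R}$, $\int_V g\,d\mu=\sum_{x\in V}\mu(x)g(x)$, and $\mathrm{Vol}(V)=\sum_{x\in V}\mu(x)$. The Sobolev space is $\mathbf{W}^{1,2}(V)=\{u:V\to\mathbb{R}\mid\int_V(|\nabla u|^2+u^2)\,d\mu<+\infty\}$ (since $V$ is finite, this is the space of all functions on $V$). The $(k+1)$-th (distinct) non-zero eigenvalue is $$\lambda_{k+1}(V)=\inf_{u\in E_k^{\perp},\ \int_V u^2\,d\mu=1}\int_V|\nabla u|^2\,d\mu ,$$ and $E_{\lambda_s(V)}=\{u:V\to\mathbb{R}\mid-\Delta u=\lambda_s(V)u\}$, of dimension $n_s$. Orthonormality is with respect to the inner product $\int_V uv\,d\mu$. *)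

theory Defs
  imports "HOL-Analysis.Analysis"
begin

text \<open>
  The vertex set is the universe of a finite type \<open>'v\<close>, and a function on the vertices is a
  vector \<open>u :: real^'v\<close>, so that \<^const>\<open>span\<close>, \<^const>\<open>dim\<close> etc. are available for
  function spaces on the graph. The set \<open>E\<close> contains an undirected edge in both orientations;
  the values of \<open>w\<close> off \<open>E\<close> are irrelevant. Loops are not excluded, since they contribute
  nothing to the Laplacian or the gradient.
\<close>

definition weighted_graph :: "('v::finite \<times> 'v) set \<Rightarrow> ('v \<Rightarrow> 'v \<Rightarrow> real) \<Rightarrow> ('v \<Rightarrow> real) \<Rightarrow> bool" where
  "weighted_graph E w \<mu> \<longleftrightarrow>
     sym E \<and> (\<forall>x y. (x, y) \<in> E\<^sup>*) \<and>
     (\<forall>(x, y)\<in>E. w x y > 0 \<and> w x y = w y x) \<and>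
     (\<forall>x. \<mu> x > 0)"

definition laplacian :: "('v::finite \<times> 'v) set \<Rightarrow> ('v \<Rightarrow> 'v \<Rightarrow> real) \<Rightarrow> ('v \<Rightarrow> real) \<Rightarrow> real^'v \<Rightarrow> real^'v" where
  "laplacian E w \<mu> u = (\<chi> x. 1 / \<mu> x * (\<Sum>y | (x, y) \<in> E. w x y * (u $ y - u $ x)))"

definition grad_norm :: "('v::finite \<times> 'v) set \<Rightarrow> ('v \<Rightarrow> 'v \<Rightarrow> real) \<Rightarrow> ('v \<Rightarrow> real) \<Rightarrow> real^'v \<Rightarrow> 'v \<Rightarrow> real" where
  "grad_norm E w \<mu> u x = sqrt (1 / (2 * \<mu> x) * (\<Sum>y | (x, y) \<in> E. w x y * (u $ y - u $ x)\<^sup>2))"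

definition vint :: "('v::finite \<Rightarrow> real) \<Rightarrow> ('v \<Rightarrow> real) \<Rightarrow> real" where
  "vint \<mu> g = (\<Sum>x\<in>UNIV. \<mu> x * g x)"

definition vol :: "('v::finite \<Rightarrow> real) \<Rightarrow> real" where
  "vol \<mu> = (\<Sum>x\<in>UNIV. \<mu> x)"

text \<open>On a finite graph this is the space of all functions.\<close>

definition sobolev :: "('v::finite \<times> 'v) set \<Rightarrow> ('v \<Rightarrow> 'v \<Rightarrow> real) \<Rightarrow> ('v \<Rightarrow> real) \<Rightarrow> (real^'v) set" where
  "sobolev E w \<mu> = {u. ereal (vint \<mu> (\<lambda>x. (grad_norm E w \<mu> u x)\<^sup>2 + (u $ x)\<^sup>2)) < \<infinity>}"

definition mean_zero :: "('v::finite \<times> 'v) set \<Rightarrow> ('v \<Rightarrow> 'v \<Rightarrow> real) \<Rightarrow> ('v \<Rightarrow> real) \<Rightarrow> (real^'v) set" where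
  "mean_zero E w \<mu> = {u \<in> sobolev E w \<mu>. vint \<mu> (\<lambda>x. u $ x) = 0}"

definition J_functional ::
  "('v::finite \<times> 'v) set \<Rightarrow> ('v \<Rightarrow> 'v \<Rightarrow> real) \<Rightarrow> ('v \<Rightarrow> real) \<Rightarrow> ('v \<Rightarrow> real) \<Rightarrow> real \<Rightarrow> real \<Rightarrow> real^'v \<Rightarrow> real" where
  "J_functional E w \<mu> h \<alpha> \<beta> u =
     1 / 2 * vint \<mu> (\<lambda>x. (grad_norm E w \<mu> u x)\<^sup>2 - \<alpha> * (u $ x)\<^sup>2)
     - \<beta> * ln (vint \<mu> (\<lambda>x. h x * exp (u $ x)))"

definition eigenspace ::
  "('v::finite \<times> 'v) set \<Rightarrow> ('v \<Rightarrow> 'v \<Rightarrow> real) \<Rightarrow> ('v \<Rightarrow> real) \<Rightarrow> real \<Rightarrow> (real^'v) set" where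
  "eigenspace E w \<mu> l = {u. - laplacian E w \<mu> u = l *\<^sub>R u}"

definition eigenvalues ::
  "('v::finite \<times> 'v) set \<Rightarrow> ('v \<Rightarrow> 'v \<Rightarrow> real) \<Rightarrow> ('v \<Rightarrow> real) \<Rightarrow> real set" where
  "eigenvalues E w \<mu> = {l. \<exists>u. u \<noteq> 0 \<and> - laplacian E w \<mu> u = l *\<^sub>R u}"

definition orthonormal_basis ::
  "('v::finite \<Rightarrow> real) \<Rightarrow> (real^'v) set \<Rightarrow> 'i set \<Rightarrow> ('i \<Rightarrow> real^'v) \<Rightarrow> bool" where
  "orthonormal_basis \<mu> S I b \<longleftrightarrow>
     (\<forall>i\<in>I. \<forall>j\<in>I. vint \<mu> (\<lambda>x. b i $ x * b j $ x) = (if i = j then 1 else 0)) \<and>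
     span (b ` I) = S"

text \<open>
  The sum of the eigenspaces of \<open>lam 1, \<dots>, lam j\<close>; it is automatically direct when these
  numbers are distinct.
\<close>

definition eigensum ::
  "('v::finite \<times> 'v) set \<Rightarrow> ('v \<Rightarrow> 'v \<Rightarrow> real) \<Rightarrow> ('v \<Rightarrow> real) \<Rightarrow> (nat \<Rightarrow> real) \<Rightarrow> nat \<Rightarrow> (real^'v) set" where
  "eigensum E w \<mu> lam j = {\<Sum>s=1..j. f s | f. \<forall>s\<in>{1..j}. f s \<in> eigenspace E w \<mu> (lam s)}"

definition eigensum_perp ::
  "('v::finite \<times> 'v) set \<Rightarrow> ('v \<Rightarrow> 'v \<Rightarrow> real) \<Rightarrow> ('v \<Rightarrow> real) \<Rightarrow> (nat \<Rightarrow> real) \<Rightarrow> nat \<Rightarrow> (real^'v) set" where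
  "eigensum_perp E w \<mu> lam j =
     {u \<in> mean_zero E w \<mu>. \<forall>v\<in>eigensum E w \<mu> lam j. vint \<mu> (\<lambda>x. u $ x * v $ x) = 0}"

text \<open>
  In the Kazdan--Warner equation below, \<open>b s i\<close> for \<open>1 \<le> i \<le> n s\<close> are the basis functions of
  the eigenspace number \<open>s\<close>, and the correction terms run over the eigenspaces \<open>1, \<dots>, j\<close>.
\<close>

definition kazdan_warner ::
  "('v::finite \<times> 'v) set \<Rightarrow> ('v \<Rightarrow> 'v \<Rightarrow> real) \<Rightarrow> ('v \<Rightarrow> real) \<Rightarrow> ('v \<Rightarrow> real) \<Rightarrow>
   (nat \<Rightarrow> nat) \<Rightarrow> (nat \<Rightarrow> nat \<Rightarrow> real^'v) \<Rightarrow> nat \<Rightarrow> real \<Rightarrow> real \<Rightarrow> real^'v \<Rightarrow> bool" where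
  "kazdan_warner E w \<mu> h n b j \<alpha> \<beta> u \<longleftrightarrow>
     (\<forall>x. laplacian E w \<mu> u $ x + \<alpha> * u $ x =
        - (\<beta> * h x * exp (u $ x) / vint \<mu> (\<lambda>y. h y * exp (u $ y)))
        + \<beta> / vol \<mu>
        + (\<Sum>s=1..j. \<Sum>i=1..n s.
             \<beta> * vint \<mu> (\<lambda>y. h y * b s i $ y * exp (u $ y)) / vint \<mu> (\<lambda>y. h y * exp (u $ y))
             * b s i $ x))"

definition has_minimizer_on :: "('a \<Rightarrow> real) \<Rightarrow> 'a set \<Rightarrow> bool" where
  "has_minimizer_on F S \<longleftrightarrow> (\<exists>u\<in>S. \<forall>v\<in>S. F u \<le> F v)"

end

theory Submission
  imports Defs "HOL-Real_Asymp.Real_Asymp"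
begin

text \<open>
  The function space is finite-dimensional, so every analytic question reduces to how the
  functional behaves far out in the linear space \<open>S = E\<^sub>j\<^sup>\<bottom>\<close>. Write \<open>\<langle>u, v\<rangle>\<close> for the inner product
  of \<open>L\<^sup>2(\<mu>)\<close>. By Green's formula the Laplacian is self-adjoint and the Dirichlet energy is
  \<open>- \<langle>\<Delta>u, u\<rangle>\<close>, hence \<open>J\<close> is half the quadratic form \<open>- \<langle>\<Delta>u, u\<rangle> - \<alpha> \<langle>u, u\<rangle>\<close> minus \<open>\<beta>\<close> times the
  logarithmic term \<open>ln (\<integral> h e\<^sup>u)\<close>, and the latter grows at most linearly.

  \<^bold>\<open>Unboundedness.\<close> An eigenfunction \<open>\<phi>\<close> for \<open>\<lambda>\<^bsub>k+1\<^esub>\<close> lies in \<open>E\<^sub>k\<^sup>\<bottom>\<close>. Along the ray \<open>t \<phi>\<close> the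
  quadratic part is \<open>(\<lambda>\<^bsub>k+1\<^esub> - \<alpha>) t\<^sup>2 \<langle>\<phi>, \<phi>\<rangle> / 2\<close>. For \<open>\<alpha> > \<lambda>\<^bsub>k+1\<^esub>\<close> it beats the linear
  term whatever \<open>\<beta>\<close> is (\<open>J_ray_supercritical\<close>); for \<open>\<alpha> = \<lambda>\<^bsub>k+1\<^esub>\<close> it vanishes, and since \<open>\<phi>\<close> has mean
  zero it is positive somewhere, which makes the logarithm grow linearly (\<open>J_ray_critical\<close>).

  \<^bold>\<open>Spectral gap.\<close> On any nonzero subspace invariant under the
  Laplacian, a minimizer of the Rayleigh quotient is itself an eigenvector of the graph
  (\<open>rayleigh_minimizer\<close>). For \<open>E\<^sub>j\<^sup>\<bottom>\<close> this eigenvector has mean zero, so by connectedness its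
  eigenvalue is nonzero, and it is orthogonal to the first \<open>j\<close> eigenspaces, so its eigenvalue is
  some \<open>\<lambda>\<^sub>s\<close> with \<open>s > j\<close> (\<open>perp_spectral_gap\<close>).

  \<^bold>\<open>Minimizers.\<close> On \<open>E\<^sub>k\<^sup>\<bottom>\<close> the gap makes \<open>J\<close> with \<open>\<alpha> = \<lambda>\<^bsub>k+1\<^esub>\<close>, \<open>\<beta> = 0\<close> nonnegative, so \<open>0\<close> is a
  minimizer. On \<open>E\<^bsub>k+1\<^esub>\<^sup>\<bottom>\<close> the quadratic part is strictly coercive, and for \<open>\<beta> < 0\<close> the logarithmic
  term is bounded below because a mean-zero function is nonnegative at some vertex
  (\<open>J_has_minimizer_on\<close>). The Euler--Lagrange equation of a minimizer on \<open>E\<^sub>j\<^sup>\<bottom>\<close> holds modulo the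
  orthogonal complement of \<open>E\<^sub>j\<^sup>\<bottom>\<close>, that is, modulo constants and the first \<open>j\<close> eigenspaces; the
  coefficients of these Lagrange multipliers are exactly those in the Kazdan--Warner equation
  (\<open>kazdan_warner_of_minimizer\<close>).
\<close>

section \<open>Existence of minimizers and unboundedness from below\<close>

text \<open>
  The direct method: a quadratic lower bound makes the sublevel set of any point of \<open>S\<close> compact,
  and a minimum over that sublevel set is a minimum over \<open>S\<close>.
\<close>
lemma coercive_has_minimizer_on:
  fixes F :: "'a::euclidean_space \<Rightarrow> real"
  assumes S: "closed S" "S \<noteq> {}" and F: "continuous_on UNIV F" and c: "c > 0"
    and bound: "\<And>u. u \<in> S \<Longrightarrow> c * (norm u)\<^sup>2 - C \<le> F u"
  shows "has_minimizer_on F S"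
proof -
  obtain a where a: "a \<in> S" using S by auto
  let ?K = "S \<inter> {u. F u \<le> F a}"
  have "closed ?K"
    by (intro closed_Int S closed_Collect_le F continuous_intros)
  moreover have "norm u \<le> sqrt ((F a + C) / c)" if "u \<in> ?K" for u
  proof (rule real_le_rsqrt)
    have "c * (norm u)\<^sup>2 \<le> F a + C" using that bound[of u] by auto
    then show "(norm u)\<^sup>2 \<le> (F a + C) / c" using c by (simp add: field_simps)
  qed
  then have "bounded ?K" by (auto simp: bounded_iff)
  ultimately have "compact ?K" by (simp add: compact_eq_bounded_closed)
  then obtain u where u: "u \<in> ?K" "\<forall>v\<in>?K. F u \<le> F v"
    using continuous_attains_inf[of ?K F] a F continuous_on_subset by blast
  then have "F u \<le> F v" if "v \<in> S" for v
    using that by (cases "F v \<le> F a") auto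
  with u show ?thesis by (auto simp: has_minimizer_on_def)
qed

lemma INF_along_ray:
  fixes F :: "'a::real_vector \<Rightarrow> real"
  assumes "subspace S" "\<phi> \<in> S"
    and lim: "filterlim g at_bot at_top" and le: "\<And>t. t \<ge> 0 \<Longrightarrow> F (t *\<^sub>R \<phi>) \<le> g t"
  shows "(INF u\<in>S. ereal (F u)) = -\<infinity>"
proof (rule ereal_bot)
  fix B :: real
  have "eventually (\<lambda>t. g t \<le> B \<and> t \<ge> 0) at_top"
    using lim by (intro eventually_conj eventually_ge_at_top) (auto simp: filterlim_at_bot)
  then obtain t where t: "g t \<le> B" "t \<ge> 0"
    using eventually_happens'[of at_top] by force
  have "(INF u\<in>S. ereal (F u)) \<le> ereal (F (t *\<^sub>R \<phi>))"
    using assms by (intro INF_lower) (auto simp: subspace_scale)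
  also have "\<dots> \<le> ereal B" using le[of t] t by simp
  finally show "(INF u\<in>S. ereal (F u)) \<le> ereal B" .
qed

section \<open>The weighted inner product and the Laplacian\<close>

definition mu_inner :: "('v::finite \<Rightarrow> real) \<Rightarrow> real^'v \<Rightarrow> real^'v \<Rightarrow> real" where
  "mu_inner \<mu> u v = vint \<mu> (\<lambda>x. u $ x * v $ x)"

lemma mu_inner_commute: "mu_inner \<mu> u v = mu_inner \<mu> v u"
  by (simp add: mu_inner_def mult.commute)

lemma mu_inner_add_left: "mu_inner \<mu> (u + v) z = mu_inner \<mu> u z + mu_inner \<mu> v z"
  by (simp add: mu_inner_def vint_def algebra_simps sum.distrib)

lemma mu_inner_diff_left: "mu_inner \<mu> (u - v) z = mu_inner \<mu> u z - mu_inner \<mu> v z"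
  by (simp add: mu_inner_def vint_def algebra_simps sum_subtractf)

lemma mu_inner_scaleR_left: "mu_inner \<mu> (c *\<^sub>R u) z = c * mu_inner \<mu> u z"
  by (simp add: mu_inner_def vint_def algebra_simps sum_distrib_left)

lemma mu_inner_minus_left: "mu_inner \<mu> (- u) z = - mu_inner \<mu> u z"
  by (simp add: mu_inner_def vint_def sum_negf)

lemma mu_inner_zero_left: "mu_inner \<mu> 0 z = 0"
  by (simp add: mu_inner_def vint_def)

lemma mu_inner_sum_left: "mu_inner \<mu> (\<Sum>i\<in>A. f i) z = (\<Sum>i\<in>A. mu_inner \<mu> (f i) z)"
  by (induction A rule: infinite_finite_induct) (auto simp: mu_inner_zero_left mu_inner_add_left)

lemmas mu_inner_left = mu_inner_add_left mu_inner_diff_left mu_inner_scaleR_left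
  mu_inner_minus_left mu_inner_zero_left mu_inner_sum_left

lemma mu_inner_add_right: "mu_inner \<mu> z (u + v) = mu_inner \<mu> z u + mu_inner \<mu> z v"
  and mu_inner_scaleR_right: "mu_inner \<mu> z (c *\<^sub>R u) = c * mu_inner \<mu> z u"
  and mu_inner_zero_right: "mu_inner \<mu> z 0 = 0"
  and mu_inner_sum_right: "mu_inner \<mu> z (\<Sum>i\<in>A. f i) = (\<Sum>i\<in>A. mu_inner \<mu> z (f i))"
  by (simp_all add: mu_inner_commute[of \<mu> z] mu_inner_left)

lemmas mu_inner_right = mu_inner_add_right mu_inner_scaleR_right mu_inner_zero_right
  mu_inner_sum_right

lemma mu_inner_span_zero:
  assumes "v \<in> span B" "\<And>z. z \<in> B \<Longrightarrow> mu_inner \<mu> u z = 0"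
  shows "mu_inner \<mu> u v = 0"
  using assms(1) by (induction rule: span_induct_alt) (auto simp: mu_inner_right assms(2))

lemma continuous_on_mu_inner [continuous_intros]:
  assumes "continuous_on S f" "continuous_on S g"
  shows "continuous_on S (\<lambda>u. mu_inner \<mu> (f u) (g u))"
  unfolding mu_inner_def vint_def by (intro continuous_intros assms)

lemma laplacian_add: "laplacian E w \<mu> (u + v) = laplacian E w \<mu> u + laplacian E w \<mu> v"
  by (simp add: laplacian_def vec_eq_iff sum.distrib sum_subtractf algebra_simps
      add_divide_distrib diff_divide_distrib)

lemma laplacian_scaleR: "laplacian E w \<mu> (c *\<^sub>R u) = c *\<^sub>R laplacian E w \<mu> u"
  by (simp add: laplacian_def vec_eq_iff sum_distrib_left right_diff_distrib mult.left_commute)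

lemma linear_laplacian: "linear (laplacian E w \<mu>)"
  by (rule linearI) (simp_all add: laplacian_add laplacian_scaleR)

lemma laplacian_zero [simp]: "laplacian E w \<mu> 0 = 0"
  by (simp add: linear_0 linear_laplacian)

lemma laplacian_constant: "laplacian E w \<mu> (\<chi> x. c) = 0"
  by (simp add: laplacian_def vec_eq_iff)

locale finite_weighted_graph =
  fixes E :: "('v::finite \<times> 'v) set" and w :: "'v \<Rightarrow> 'v \<Rightarrow> real" and \<mu> :: "'v \<Rightarrow> real"
  assumes graph: "weighted_graph E w \<mu>"
begin

abbreviation lap :: "real^'v \<Rightarrow> real^'v" where "lap \<equiv> laplacian E w \<mu>"
abbreviation ip :: "real^'v \<Rightarrow> real^'v \<Rightarrow> real" where "ip \<equiv> mu_inner \<mu>"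
abbreviation one :: "real^'v" where "one \<equiv> (\<chi> x. 1)"

lemma mu_pos: "\<mu> x > 0"
  and symE: "sym E"
  and conn: "(x, y) \<in> E\<^sup>*"
  and w_pos: "(x, y) \<in> E \<Longrightarrow> w x y > 0"
  and w_sym: "(x, y) \<in> E \<Longrightarrow> w x y = w y x"
  using graph by (auto simp: weighted_graph_def)

lemma mu_inner_self_lower: "\<exists>c>0. \<forall>u. c * (norm u)\<^sup>2 \<le> ip u u"
proof (intro exI conjI allI)
  let ?c = "Min (range \<mu>)"
  show "?c > 0" using mu_pos by auto
  fix u :: "real^'v"
  have "?c * (norm u)\<^sup>2 = (\<Sum>x\<in>UNIV. ?c * (u $ x * u $ x))"
    by (simp add: power2_norm_eq_inner inner_vec_def sum_distrib_left)
  also have "\<dots> \<le> ip u u"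
    unfolding mu_inner_def vint_def by (intro sum_mono mult_right_mono) auto
  finally show "?c * (norm u)\<^sup>2 \<le> ip u u" .
qed

lemma mu_inner_self_eq_0: "ip u u = 0 \<longleftrightarrow> u = 0"
  using mu_inner_self_lower mu_inner_zero_left
  by (metis mult_pos_pos not_le zero_less_norm_iff zero_less_power)

lemma mu_inner_self_nonneg: "ip u u \<ge> 0"
  unfolding mu_inner_def vint_def by (simp add: sum_nonneg mu_pos less_imp_le)

section \<open>Green's formula\<close>

lemma sum_edges: "(\<Sum>x\<in>UNIV. \<Sum>y | (x, y) \<in> E. f x y) = (\<Sum>(x, y)\<in>E. f x y)"
proof -
  have "Sigma UNIV (\<lambda>x. {y. (x, y) \<in> E}) = E" by auto
  then show ?thesis by (simp add: sum.Sigma)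
qed

lemma sum_edges_swap: "(\<Sum>(x, y)\<in>E. f x y) = (\<Sum>(x, y)\<in>E. f y x)"
  by (rule sum.reindex_bij_witness[where i = prod.swap and j = prod.swap])
     (use symE in \<open>auto simp: sym_def\<close>)

text \<open>
  Summation by parts: the edge set is symmetric, so relabelling each edge \<open>(x, y)\<close> as \<open>(y, x)\<close>
  gives a second expression for the same quantity, and averaging the two produces the difference
  of \<open>v\<close>.
\<close>
lemma green:
  "ip (lap u) v = - (1/2) * (\<Sum>(x, y)\<in>E. w x y * (u $ y - u $ x) * (v $ y - v $ x))"
proof -
  have 1: "ip (lap u) v = (\<Sum>(x, y)\<in>E. w x y * (u $ y - u $ x) * v $ x)"
  proof -
    have "ip (lap u) v = (\<Sum>x\<in>UNIV. \<Sum>y | (x, y) \<in> E. w x y * (u $ y - u $ x) * v $ x)"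
      unfolding mu_inner_def vint_def laplacian_def
      using mu_pos by (intro sum.cong refl) (simp add: sum_distrib_right order_less_imp_not_eq2)
    then show ?thesis by (simp add: sum_edges)
  qed
  also have "\<dots> = (\<Sum>(x, y)\<in>E. w y x * (u $ x - u $ y) * v $ y)"
    by (rule sum_edges_swap)
  also have "\<dots> = (\<Sum>(x, y)\<in>E. w x y * (u $ x - u $ y) * v $ y)"
    by (intro sum.cong refl) (clarsimp, metis w_sym)
  finally have 2: "ip (lap u) v = (\<Sum>(x, y)\<in>E. w x y * (u $ x - u $ y) * v $ y)" .
  have "ip (lap u) v + ip (lap u) v =
      (\<Sum>(x, y)\<in>E. - (w x y * (u $ y - u $ x) * (v $ y - v $ x)))"
    by (subst 1, subst 2, subst sum.distrib[symmetric])
       (intro sum.cong, auto simp: algebra_simps)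
  also have "\<dots> = - (\<Sum>(x, y)\<in>E. w x y * (u $ y - u $ x) * (v $ y - v $ x))"
    by (simp add: sum_negf[symmetric] case_prod_beta)
  finally show ?thesis by simp
qed

lemma lap_selfadjoint: "ip (lap u) v = ip u (lap v)"
proof -
  have "ip (lap u) v = ip (lap v) u"
    unfolding green by (simp add: mult.assoc mult.commute[of "u $ _ - u $ _"])
  then show ?thesis by (simp add: mu_inner_commute)
qed

lemma grad_norm_sq: "(grad_norm E w \<mu> u x)\<^sup>2 =
    1 / (2 * \<mu> x) * (\<Sum>y | (x, y) \<in> E. w x y * (u $ y - u $ x)\<^sup>2)"
proof -
  have "(\<Sum>y | (x, y) \<in> E. w x y * (u $ y - u $ x)\<^sup>2) \<ge> 0"
    by (intro sum_nonneg) (auto simp: w_pos less_imp_le)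
  then show ?thesis
    unfolding grad_norm_def using mu_pos[of x] by (subst real_sqrt_pow2) auto
qed

lemma energy_eq: "vint \<mu> (\<lambda>x. (grad_norm E w \<mu> u x)\<^sup>2) = - ip (lap u) u"
proof -
  have "vint \<mu> (\<lambda>x. (grad_norm E w \<mu> u x)\<^sup>2) =
      (\<Sum>x\<in>UNIV. \<Sum>y | (x, y) \<in> E. (1/2) * (w x y * (u $ y - u $ x)\<^sup>2))"
    unfolding vint_def grad_norm_sq using mu_pos
    by (intro sum.cong refl) (simp add: sum_divide_distrib[symmetric] order_less_imp_not_eq2)
  also have "\<dots> = (1/2) * (\<Sum>(x, y)\<in>E. w x y * (u $ y - u $ x)\<^sup>2)"
    by (simp add: sum_edges sum_distrib_left case_prod_beta)
  also have "\<dots> = - ip (lap u) u"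
    unfolding green by (simp add: power2_eq_square mult.assoc)
  finally show ?thesis .
qed

text \<open>
  The energy of a harmonic function vanishes, so the function takes equal values at the ends of
  each edge; connectedness spreads this to all vertices.
\<close>
lemma lap_kernel_constant:
  assumes "lap u = 0" shows "u $ x = u $ y"
proof -
  have "(\<Sum>(x, y)\<in>E. w x y * (u $ y - u $ x) * (u $ y - u $ x)) = 0"
    using green[of u u] assms by (simp add: mu_inner_zero_left)
  then have "\<forall>p\<in>E. (case p of (x, y) \<Rightarrow> w x y * (u $ y - u $ x) * (u $ y - u $ x)) = 0"
    by (subst (asm) sum_nonneg_eq_0_iff)
       (auto simp: mult.assoc intro: mult_nonneg_nonneg[OF less_imp_le[OF w_pos] zero_le_square])
  then have edge: "u $ a = u $ b" if "(a, b) \<in> E" for a b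
    using that w_pos[OF that] by fastforce
  show ?thesis using conn[of x y] by (induction rule: rtrancl_induct) (auto dest: edge)
qed

lemma lap_mean_zero: "ip (lap u) one = 0"
  by (simp add: lap_selfadjoint laplacian_constant mu_inner_zero_right)

lemma lap_injective_mean_zero:
  assumes "lap u = 0" "ip u one = 0" shows "u = 0"
proof -
  obtain c where c: "u = c *\<^sub>R one"
  proof (rule that)
    show "u = (u $ undefined) *\<^sub>R one"
      using lap_kernel_constant[OF assms(1)] by (simp add: vec_eq_iff)
  qed
  have "ip u u = 0"
    using assms(2) c by (metis mu_inner_scaleR_right mult_zero_right)
  then show ?thesis by (simp add: mu_inner_self_eq_0)
qed

lemma eigenvector_mean_zero:
  assumes "- lap u = l *\<^sub>R u" "l \<noteq> 0" shows "ip u one = 0"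
  using lap_mean_zero[of u] assms
  by (metis mu_inner_minus_left mu_inner_scaleR_left mult_eq_0_iff neg_equal_0_iff_equal)

lemma eigenvectors_orthogonal:
  assumes "- lap u = l *\<^sub>R u" "- lap v = l' *\<^sub>R v" "l \<noteq> l'" shows "ip u v = 0"
proof -
  have "l * ip u v = - ip (lap u) v"
    by (metis assms(1) mu_inner_minus_left mu_inner_scaleR_left)
  also have "\<dots> = - ip (lap v) u" by (metis lap_selfadjoint mu_inner_commute)
  also have "\<dots> = l' * ip u v"
    by (metis assms(2) mu_inner_minus_left mu_inner_scaleR_left mu_inner_commute)
  finally show ?thesis using assms(3) by simp
qed

section \<open>The functional and its Euler--Lagrange equation\<close>

lemma J_eq: "J_functional E w \<mu> h \<alpha> \<beta> u =
  1/2 * (- ip (lap u) u - \<alpha> * ip u u) - \<beta> * ln (vint \<mu> (\<lambda>x. h x * exp (u $ x)))"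
proof -
  have "vint \<mu> (\<lambda>x. (grad_norm E w \<mu> u x)\<^sup>2 - \<alpha> * (u $ x)\<^sup>2) =
      vint \<mu> (\<lambda>x. (grad_norm E w \<mu> u x)\<^sup>2) - \<alpha> * ip u u"
    by (simp add: mu_inner_def vint_def right_diff_distrib sum_subtractf sum_distrib_left
        power2_eq_square mult.left_commute)
  then show ?thesis by (simp add: J_functional_def energy_eq)
qed

lemma partition_term_le:
  assumes "\<forall>x. h x > 0"
  shows "\<mu> x * (h x * exp (u $ x)) \<le> vint \<mu> (\<lambda>x. h x * exp (u $ x))"
  unfolding vint_def
  by (rule member_le_sum) (use assms mu_pos in \<open>auto intro!: mult_nonneg_nonneg simp: less_imp_le\<close>)

lemma partition_pos:
  assumes "\<forall>x. h x > 0" shows "vint \<mu> (\<lambda>x. h x * exp (u $ x)) > 0"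
  using partition_term_le[OF assms, of undefined u] assms mu_pos[of undefined]
  by (smt (verit) exp_gt_zero mult_pos_pos)

text \<open>
  A sum of positive terms dominates each of them. The resulting bound is used both for the growth
  of the logarithm along a ray and for its lower bound on mean-zero functions.
\<close>
lemma ln_partition_ge:
  assumes "\<forall>x. h x > 0"
  shows "ln (\<mu> x * h x) + u $ x \<le> ln (vint \<mu> (\<lambda>x. h x * exp (u $ x)))"
proof -
  have "ln (\<mu> x * h x) + u $ x = ln (\<mu> x * (h x * exp (u $ x)))"
    using assms mu_pos[of x] by (simp add: ln_mult_pos mult.assoc[symmetric])
  also have "\<dots> \<le> ln (vint \<mu> (\<lambda>x. h x * exp (u $ x)))"
    using partition_term_le[OF assms, of x u] assms mu_pos[of x] by (intro ln_mono) auto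
  finally show ?thesis .
qed

text \<open>
  Since \<open>\<bar>u $ x\<bar> \<le> norm u\<close>, the weight \<open>e\<^sup>u\<close> lies between \<open>e\<^bsup>-norm u\<^esup>\<close> and \<open>e\<^bsup>norm u\<^esup>\<close>; this is the linear
  growth of the logarithmic term.
\<close>
lemma ln_partition_bounds:
  assumes "\<forall>x. h x > 0"
  shows "\<bar>ln (vint \<mu> (\<lambda>x. h x * exp (u $ x))) - ln (vint \<mu> h)\<bar> \<le> norm u"
proof -
  let ?H = "vint \<mu> h" and ?Z = "vint \<mu> (\<lambda>x. h x * exp (u $ x))"
  have H: "?H > 0" using partition_pos[OF assms, of 0] by simp
  have comp: "\<bar>u $ x\<bar> \<le> norm u" for x using component_le_norm_cart .
  have "?H * exp (- norm u) = (\<Sum>x\<in>UNIV. \<mu> x * (h x * exp (- norm u)))"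
    by (simp add: vint_def sum_distrib_right mult.assoc)
  also have "\<dots> \<le> ?Z"
    unfolding vint_def using assms mu_pos comp
    by (intro sum_mono mult_left_mono) (auto simp: less_imp_le abs_le_iff minus_le_iff)
  finally have lo: "?H * exp (- norm u) \<le> ?Z" .
  have "?Z \<le> (\<Sum>x\<in>UNIV. \<mu> x * (h x * exp (norm u)))"
    unfolding vint_def using assms mu_pos comp
    by (intro sum_mono mult_left_mono) (auto simp: less_imp_le abs_le_iff)
  also have "\<dots> = ?H * exp (norm u)"
    by (simp add: vint_def sum_distrib_right mult.assoc)
  finally have hi: "?Z \<le> ?H * exp (norm u)" .
  have "ln (?H * exp (- norm u)) \<le> ln ?Z" "ln ?Z \<le> ln (?H * exp (norm u))"
    using lo hi H partition_pos[OF assms, of u] by (auto intro!: ln_mono)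
  then show ?thesis using H by (simp add: ln_mult_pos abs_le_iff)
qed

lemma continuous_J:
  assumes "\<forall>x. h x > 0" shows "continuous_on UNIV (J_functional E w \<mu> h \<alpha> \<beta>)"
proof -
  have l: "continuous_on UNIV lap"
    by (rule linear_continuous_on) (simp add: linear_laplacian linear_linear)
  have ne: "(\<Sum>x\<in>UNIV. \<mu> x * (h x * exp (u $ x))) \<noteq> 0" for u :: "real^'v"
    using partition_pos[OF assms, of u] by (simp add: vint_def)
  show ?thesis
    unfolding J_eq vint_def by (intro continuous_intros l ballI ne)
qed

text \<open>
  The derivative of \<open>t \<mapsto> J (u + t \<phi>)\<close> vanishes at \<open>t = 0\<close>. The case \<open>\<beta> = 0\<close> serves the spectral gap,
  the general case the Kazdan--Warner equation.
\<close>
lemma euler_lagrange: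
  assumes h: "\<forall>x. h x > 0" and S: "subspace S" and u: "u \<in> S" and \<phi>: "\<phi> \<in> S"
    and min: "\<And>v. v \<in> S \<Longrightarrow> J_functional E w \<mu> h \<alpha> \<beta> u \<le> J_functional E w \<mu> h \<alpha> \<beta> v"
  shows "ip (- lap u - \<alpha> *\<^sub>R u
    - (\<beta> / vint \<mu> (\<lambda>x. h x * exp (u $ x))) *\<^sub>R (\<chi> x. h x * exp (u $ x))) \<phi> = 0"
proof -
  let ?Z = "\<lambda>t. \<Sum>x\<in>UNIV. \<mu> x * (h x * exp (u $ x + t * \<phi> $ x))"
  let ?f = "\<lambda>t. J_functional E w \<mu> h \<alpha> \<beta> (u + t *\<^sub>R \<phi>)"
  let ?A = "\<lambda>u v. - ip (lap u) v - \<alpha> * ip u v"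
  have sym: "ip (lap \<phi>) u = ip (lap u) \<phi>" "ip \<phi> u = ip u \<phi>"
    by (metis lap_selfadjoint mu_inner_commute) (rule mu_inner_commute)
  have f: "?f = (\<lambda>t. 1/2 * (?A u u + 2 * t * ?A u \<phi> + t * t * ?A \<phi> \<phi>) - \<beta> * ln (?Z t))"
    by (rule ext) (simp add: J_eq vint_def laplacian_add laplacian_scaleR mu_inner_left
      mu_inner_right sym algebra_simps)
  have Z: "?Z 0 > 0" using partition_pos[OF h, of u] by (simp add: vint_def)
  define D where "D = ?A u \<phi> - \<beta> * ((\<Sum>x\<in>UNIV. \<mu> x * (h x * exp (u $ x) * \<phi> $ x)) / ?Z 0)"
  have dZ: "(?Z has_real_derivative (\<Sum>x\<in>UNIV. \<mu> x * (h x * exp (u $ x) * \<phi> $ x))) (at 0)"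
    by (auto intro!: derivative_eq_intros sum.cong)
  have "((\<lambda>t. ln (?Z t)) has_real_derivative
      (\<Sum>x\<in>UNIV. \<mu> x * (h x * exp (u $ x) * \<phi> $ x)) / ?Z 0) (at 0)"
    using DERIV_chain2[OF DERIV_ln_divide[OF Z] dZ] by simp
  then have "(?f has_real_derivative D) (at 0)"
    unfolding f D_def
    by (intro DERIV_cong[OF DERIV_diff[OF _ DERIV_cmult]]) (auto intro!: derivative_eq_intros)
  moreover have "\<forall>t. \<bar>0 - t\<bar> < 1 \<longrightarrow> ?f 0 \<le> ?f t"
    using min S u \<phi> by (auto simp: subspace_add subspace_scale)
  ultimately have "D = 0" by (intro DERIV_local_min[of ?f D 0 1]) auto
  moreover have "ip (- lap u - \<alpha> *\<^sub>R u
    - (\<beta> / vint \<mu> (\<lambda>x. h x * exp (u $ x))) *\<^sub>R (\<chi> x. h x * exp (u $ x))) \<phi> = D"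
    unfolding D_def by (simp add: mu_inner_left) (simp add: mu_inner_def vint_def)
  ultimately show ?thesis by simp
qed


section \<open>The spectral gap on an invariant subspace\<close>

text \<open>
  Minimality of the quotient at \<open>u0\<close>, with value \<open>l\<close>, says that \<open>u0\<close> minimizes the quadratic
  functional \<open>J\<close> with \<open>\<alpha> = l\<close>, \<open>\<beta> = 0\<close> over \<open>S\<close>. Its Euler--Lagrange equation states that
  \<open>- \<Delta> u0 - l u0\<close> is orthogonal to \<open>S\<close>; by invariance this vector also lies in \<open>S\<close>, so it is zero.
\<close>
lemma rayleigh_minimizer:
  assumes S: "subspace S" and inv: "\<And>u. u \<in> S \<Longrightarrow> lap u \<in> S" and nz: "S \<noteq> {0}"
  obtains u0 l where "u0 \<in> S" "u0 \<noteq> 0" "- lap u0 = l *\<^sub>R u0"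
    "\<And>u. u \<in> S \<Longrightarrow> l * ip u u \<le> - ip (lap u) u"
proof -
  let ?R = "\<lambda>u. - ip (lap u) u / ip u u"
  let ?K = "S \<inter> sphere 0 1"
  have lapc: "continuous_on UNIV lap"
    by (rule linear_continuous_on) (simp add: linear_laplacian linear_linear)
  obtain v where v: "v \<in> S" "v \<noteq> 0" using nz S subspace_0 by blast
  have "(1 / norm v) *\<^sub>R v \<in> ?K" using v S by (auto simp: subspace_scale)
  moreover have "compact ?K"
    using S by (intro closed_Int_compact closed_subspace) auto
  moreover have "continuous_on ?K ?R"
    by (intro continuous_intros continuous_on_subset[OF lapc]) (auto simp: mu_inner_self_eq_0)
  ultimately obtain u0 where u0: "u0 \<in> ?K" "\<forall>u\<in>?K. ?R u0 \<le> ?R u"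
    using continuous_attains_inf[of ?K ?R] by blast
  define l where "l = ?R u0"
  have u0S: "u0 \<in> S" "u0 \<noteq> 0" using u0 by auto
  have low: "l * ip u u \<le> - ip (lap u) u" if "u \<in> S" for u
  proof (cases "u = 0")
    case False
    define t where "t = 1 / norm u"
    have "t \<noteq> 0" using False by (simp add: t_def)
    have "t *\<^sub>R u \<in> ?K" using that S False by (auto simp: subspace_scale t_def)
    then have "l \<le> ?R (t *\<^sub>R u)" using u0(2) unfolding l_def by blast
    also have "\<dots> = ?R u"
      using \<open>t \<noteq> 0\<close> by (simp add: laplacian_scaleR mu_inner_left mu_inner_right)
    finally have "l \<le> ?R u" .
    moreover have "ip u u > 0"
      using False mu_inner_self_nonneg[of u] mu_inner_self_eq_0[of u] by linarith
    ultimately show ?thesis by (metis pos_le_divide_eq)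
  qed (simp add: mu_inner_zero_left mu_inner_zero_right)
  have eq: "- ip (lap u0) u0 = l * ip u0 u0"
    using u0S by (simp add: l_def mu_inner_self_eq_0)
  have "J_functional E w \<mu> (\<lambda>x. 1) l 0 u0 \<le> J_functional E w \<mu> (\<lambda>x. 1) l 0 v" if "v \<in> S" for v
    using low[OF that] eq by (simp add: J_eq)
  then have "ip (- lap u0 - l *\<^sub>R u0) \<phi> = 0" if "\<phi> \<in> S" for \<phi>
    using euler_lagrange[of "\<lambda>x. 1" S u0 \<phi> l 0] S u0S that by simp
  moreover have "- lap u0 - l *\<^sub>R u0 \<in> S"
    using S inv u0S by (intro subspace_diff subspace_neg subspace_scale) auto
  ultimately have "- lap u0 - l *\<^sub>R u0 = 0"
    using mu_inner_self_eq_0 by blast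
  then have "- lap u0 = l *\<^sub>R u0" by simp
  with that u0S low show ?thesis by blast
qed

section \<open>Orthogonal complements of sums of eigenspaces\<close>

abbreviation perp :: "(nat \<Rightarrow> real) \<Rightarrow> nat \<Rightarrow> (real^'v) set" where
  "perp \<equiv> eigensum_perp E w \<mu>"

lemma eigenspace_eigenvector: "v \<in> eigenspace E w \<mu> l \<longleftrightarrow> - lap v = l *\<^sub>R v"
  by (simp add: eigenspace_def)

text \<open>
  Orthogonality to a sum of eigenspaces is tested on each summand, and being of mean zero is
  orthogonality to the constants.
\<close>
lemma eigensum_perp_iff:
  "u \<in> perp lam j \<longleftrightarrow>
     ip u one = 0 \<and> (\<forall>s\<in>{1..j}. \<forall>v\<in>eigenspace E w \<mu> (lam s). ip u v = 0)"
proof -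
  have mz: "u \<in> mean_zero E w \<mu> \<longleftrightarrow> ip u one = 0"
    by (simp add: mean_zero_def sobolev_def mu_inner_def)
  have "(\<forall>v\<in>eigensum E w \<mu> lam j. ip u v = 0) \<longleftrightarrow>
      (\<forall>s\<in>{1..j}. \<forall>v\<in>eigenspace E w \<mu> (lam s). ip u v = 0)" (is "?L \<longleftrightarrow> ?R")
  proof
    assume L: ?L
    show ?R
    proof (intro ballI)
      fix s v assume s: "s \<in> {1..j}" and v: "v \<in> eigenspace E w \<mu> (lam s)"
      have "v = (\<Sum>r=1..j. if r = s then v else 0)" using s by simp
      then have "v \<in> eigensum E w \<mu> lam j"
        unfolding eigensum_def using v
        by (intro CollectI exI[of _ "\<lambda>r. if r = s then v else 0"]) (auto simp: eigenspace_def)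
      with L show "ip u v = 0" by blast
    qed
  next
    assume ?R
    then show ?L by (auto simp: eigensum_def mu_inner_sum_right intro!: sum.neutral)
  qed
  then show ?thesis unfolding mz[symmetric] by (simp add: eigensum_perp_def mu_inner_def)
qed

lemma subspace_perp: "subspace (perp lam j)"
  unfolding subspace_def by (auto simp: eigensum_perp_iff mu_inner_left)

lemma lap_perp:
  assumes "u \<in> perp lam j" shows "lap u \<in> perp lam j"
proof -
  have "ip (lap u) v = 0" if "s \<in> {1..j}" "v \<in> eigenspace E w \<mu> (lam s)" for s v
  proof -
    have "lap v = (- lam s) *\<^sub>R v" using that by (simp add: eigenspace_def) (metis minus_equation_iff)
    then have "ip (lap u) v = - lam s * ip u v"
      by (simp only: lap_selfadjoint mu_inner_scaleR_right)
    then show ?thesis using assms that by (simp add: eigensum_perp_iff)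
  qed
  then show ?thesis by (simp add: eigensum_perp_iff lap_mean_zero)
qed

lemma eigenvector_in_perp:
  assumes "- lap \<phi> = l *\<^sub>R \<phi>" "l \<noteq> 0" "\<And>s. s \<in> {1..j} \<Longrightarrow> lam s \<noteq> l"
  shows "\<phi> \<in> perp lam j"
  unfolding eigensum_perp_iff
  using eigenvector_mean_zero[OF assms(1,2)] eigenvectors_orthogonal[OF assms(1)] assms(3)
  by (metis eigenspace_eigenvector)

text \<open>
  The Rayleigh minimizer of \<open>E\<^sub>j\<^sup>\<bottom>\<close> cannot be constant, as it has mean zero, nor lie in one of the
  first \<open>j\<close> eigenspaces, as it would then be orthogonal to itself.
\<close>
lemma perp_spectral_gap:
  assumes lam_all: "lam ` {1..M} = eigenvalues E w \<mu> - {0}" and nz: "perp lam j \<noteq> {0}"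
  obtains s where "s \<in> {j+1..M}" "\<And>u. u \<in> perp lam j \<Longrightarrow> lam s * ip u u \<le> - ip (lap u) u"
proof -
  obtain u0 l where u0: "u0 \<in> perp lam j" "u0 \<noteq> 0" "- lap u0 = l *\<^sub>R u0"
    and low: "\<And>u. u \<in> perp lam j \<Longrightarrow> l * ip u u \<le> - ip (lap u) u"
    using rayleigh_minimizer[OF subspace_perp lap_perp nz] by metis
  have "l \<noteq> 0"
    using u0 lap_injective_mean_zero[of u0] by (auto simp: eigensum_perp_iff)
  then have "l \<in> lam ` {1..M}"
    unfolding lam_all using u0 by (auto simp: eigenvalues_def)
  then obtain s where s: "s \<in> {1..M}" "l = lam s" by auto
  have "\<not> s \<le> j"
  proof
    assume "s \<le> j"
    then have "ip u0 u0 = 0"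
      using s u0 by (auto simp: eigensum_perp_iff eigenspace_def)
    then show False using u0 by (simp add: mu_inner_self_eq_0)
  qed
  then have "s \<in> {j+1..M}" using s(1) by simp
  moreover have "lam s * ip u u \<le> - ip (lap u) u" if "u \<in> perp lam j" for u
    using low[OF that] s(2) by simp
  ultimately show ?thesis by (rule that)
qed

section \<open>From minimizers to the Kazdan--Warner equation\<close>

text \<open>
  Let \<open>g\<close> be the Euler--Lagrange expression of \<open>u\<close>, which is orthogonal to \<open>E\<^sub>j\<^sup>\<bottom>\<close>, and let \<open>r\<close> be
  the difference of the two sides of the Kazdan--Warner equation. Then \<open>r\<close> is \<open>g\<close> minus its
  orthogonal projection to the constants and to the first \<open>j\<close> eigenspaces: \<open>u\<close> and \<open>\<Delta>u\<close> are
  orthogonal to all of these, so only the term \<open>h e\<^sup>u\<close> contributes to the coefficients. Hence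
  \<open>r\<close> lies in \<open>E\<^sub>j\<^sup>\<bottom>\<close> and is at the same time orthogonal to \<open>E\<^sub>j\<^sup>\<bottom>\<close>, so \<open>r = 0\<close>.
\<close>
lemma kazdan_warner_of_minimizer:
  assumes h: "\<forall>x. h x > 0"
    and basis: "\<And>s. s \<in> {1..j} \<Longrightarrow> orthonormal_basis \<mu> (eigenspace E w \<mu> (lam s)) {1..n s} (b s)"
    and inj: "inj_on lam {1..j}" and nz: "\<And>s. s \<in> {1..j} \<Longrightarrow> lam s \<noteq> 0"
    and u: "u \<in> perp lam j"
    and min: "\<And>v. v \<in> perp lam j \<Longrightarrow> J_functional E w \<mu> h \<alpha> \<beta> u \<le> J_functional E w \<mu> h \<alpha> \<beta> v"
  shows "kazdan_warner E w \<mu> h n b j \<alpha> \<beta> u"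
proof -
  define Z where "Z = vint \<mu> (\<lambda>x. h x * exp (u $ x))"
  define he :: "real^'v" where "he = (\<chi> x. h x * exp (u $ x))"
  define g where "g = - lap u - \<alpha> *\<^sub>R u - (\<beta> / Z) *\<^sub>R he"
  define c where "c = (\<lambda>s i. \<beta> / Z * ip he (b s i))"
  define r where "r = g + (\<beta> / vol \<mu>) *\<^sub>R one + (\<Sum>s=1..j. \<Sum>i=1..n s. c s i *\<^sub>R b s i)"
  have Z: "Z > 0" unfolding Z_def by (rule partition_pos[OF h])
  have vol: "ip one one = vol \<mu>" "vol \<mu> > 0"
    unfolding mu_inner_def vint_def vol_def by (auto intro!: sum_pos mu_pos)
  have heone: "ip he one = Z" by (simp add: mu_inner_def he_def Z_def)
  have eig: "- lap (b s i) = lam s *\<^sub>R b s i" if "s \<in> {1..j}" "i \<in> {1..n s}" for s i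
  proof -
    have "b s i \<in> eigenspace E w \<mu> (lam s)"
      using basis[OF that(1)] that(2) span_base[of "b s i" "b s ` {1..n s}"]
      by (auto simp: orthonormal_basis_def)
    then show ?thesis by (simp add: eigenspace_def)
  qed
  have b_one: "ip (b s i) one = 0" "ip one (b s i) = 0" if "s \<in> {1..j}" "i \<in> {1..n s}" for s i
    using eigenvector_mean_zero[OF eig[OF that]] nz that by (auto simp: mu_inner_commute[of _ one])
  have u_b: "ip u (b s i) = 0" "ip (lap u) (b s i) = 0" if "s \<in> {1..j}" "i \<in> {1..n s}" for s i
    using u lap_perp[OF u] eig[OF that] that by (auto simp: eigensum_perp_iff eigenspace_def)
  have bb: "ip (b s' i') (b s i) = (if s' = s then if i' = i then 1 else 0 else 0)"
    if "s \<in> {1..j}" "i \<in> {1..n s}" "s' \<in> {1..j}" "i' \<in> {1..n s'}" for s i s' i'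
  proof (cases "s' = s")
    case True
    then show ?thesis using basis[OF that(1)] that by (auto simp: orthonormal_basis_def mu_inner_def)
  next
    case False
    then have "lam s' \<noteq> lam s" using inj that by (auto dest: inj_onD)
    then have "ip (b s' i') (b s i) = 0"
      by (rule eigenvectors_orthogonal[OF eig[OF that(3,4)] eig[OF that(1,2)]])
    then show ?thesis using False by simp
  qed
  have r_one: "ip r one = 0"
  proof -
    have "(\<Sum>s=1..j. \<Sum>i=1..n s. c s i * ip (b s i) one) = 0"
      by (intro sum.neutral ballI) (simp add: b_one)
    then show ?thesis
      using u Z vol by (simp add: r_def g_def mu_inner_left lap_mean_zero heone eigensum_perp_iff)
  qed
  have r_b: "ip r (b s i) = 0" if s: "s \<in> {1..j}" and i: "i \<in> {1..n s}" for s i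
  proof -
    have "(\<Sum>s'=1..j. \<Sum>i'=1..n s'. c s' i' * ip (b s' i') (b s i)) =
        (\<Sum>s'=1..j. if s' = s then c s i else 0)"
    proof (intro sum.cong refl)
      fix s' assume s': "s' \<in> {1..j}"
      have "(\<Sum>i'=1..n s'. c s' i' * ip (b s' i') (b s i)) =
          (\<Sum>i'=1..n s'. if s' = s then if i' = i then c s' i' else 0 else 0)"
        using bb[OF s i s'] by (intro sum.cong refl) auto
      also have "\<dots> = (if s' = s then c s i else 0)" using i by auto
      finally show "(\<Sum>i'=1..n s'. c s' i' * ip (b s' i') (b s i)) = (if s' = s then c s i else 0)" .
    qed
    also have "\<dots> = c s i" using s by auto
    finally show ?thesis
      using s i by (simp add: r_def g_def mu_inner_left u_b b_one c_def)
  qed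
  have rS: "r \<in> perp lam j"
    unfolding eigensum_perp_iff
  proof (intro conjI ballI r_one)
    fix s v assume s: "s \<in> {1..j}" and v: "v \<in> eigenspace E w \<mu> (lam s)"
    then have "v \<in> span (b s ` {1..n s})" using basis[OF s] by (simp add: orthonormal_basis_def)
    then show "ip r v = 0" by (rule mu_inner_span_zero) (use r_b s in auto)
  qed
  have "ip g r = 0"
    using euler_lagrange[OF h subspace_perp u rS min] by (simp add: g_def he_def Z_def)
  then have "ip r r = 0"
  proof -
    have "(\<Sum>s=1..j. \<Sum>i=1..n s. c s i * ip (b s i) r) = 0"
      by (intro sum.neutral ballI) (simp add: r_b mu_inner_commute[of _ _ r])
    moreover have "ip one r = 0" using r_one by (simp add: mu_inner_commute)
    ultimately show ?thesis using \<open>ip g r = 0\<close>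
      by (subst r_def) (simp add: mu_inner_left)
  qed
  then have "r = 0" by (simp add: mu_inner_self_eq_0)
  have "lap u $ x + \<alpha> * u $ x = - (\<beta> * h x * exp (u $ x) / Z) + \<beta> / vol \<mu>
      + (\<Sum>s=1..j. \<Sum>i=1..n s. c s i * b s i $ x)" for x
  proof -
    have "r $ x = 0" using \<open>r = 0\<close> by simp
    then show ?thesis by (simp add: r_def g_def he_def mult.assoc)
  qed
  moreover have "c s i = \<beta> * vint \<mu> (\<lambda>y. h y * b s i $ y * exp (u $ y)) / Z" for s i
    by (simp add: c_def he_def mu_inner_def mult_ac)
  ultimately show ?thesis by (simp add: kazdan_warner_def Z_def)
qed

section \<open>Behaviour of the functional along an eigenfunction\<close>

text \<open>
  On the ray through \<open>\<phi>\<close> the quadratic part tends to \<open>-\<infinity>\<close> like \<open>-t\<^sup>2\<close>, while the logarithmic term is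
  at most linear in \<open>t\<close>, so the quadratic part wins for every \<open>\<beta>\<close>.
\<close>
lemma J_ray_supercritical:
  assumes h: "\<forall>x. h x > 0" and S: "subspace S" "\<phi> \<in> S" and \<phi>: "\<phi> \<noteq> 0" "- lap \<phi> = l *\<^sub>R \<phi>"
    and \<alpha>: "\<alpha> > l"
  shows "(INF u\<in>S. ereal (J_functional E w \<mu> h \<alpha> \<beta> u)) = -\<infinity>"
proof (rule INF_along_ray[OF S])
  define a where "a = (\<alpha> - l) / 2 * ip \<phi> \<phi>"
  define L where "L = \<bar>ln (vint \<mu> h)\<bar>"
  define N where "N = norm \<phi>"
  have "a > 0"
    using \<alpha> \<phi>(1) mu_inner_self_nonneg[of \<phi>] mu_inner_self_eq_0[of \<phi>] by (simp add: a_def)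
  then show "filterlim (\<lambda>t. - a * t\<^sup>2 + \<bar>\<beta>\<bar> * (L + t * N)) at_bot at_top"
    by real_asymp
  fix t :: real assume t: "t \<ge> 0"
  let ?l = "ln (vint \<mu> (\<lambda>x. h x * exp ((t *\<^sub>R \<phi>) $ x)))"
  have "\<bar>?l\<bar> \<le> L + t * N"
    using ln_partition_bounds[OF h, of "t *\<^sub>R \<phi>"] t unfolding L_def N_def norm_scaleR by linarith
  then have "\<bar>\<beta>\<bar> * \<bar>?l\<bar> \<le> \<bar>\<beta>\<bar> * (L + t * N)" by (simp add: mult_left_mono)
  then have 1: "- \<beta> * ?l \<le> \<bar>\<beta>\<bar> * (L + t * N)"
    using abs_ge_minus_self[of "\<beta> * ?l"] unfolding abs_mult by linarith
  have lp: "lap \<phi> = (- l) *\<^sub>R \<phi>" using \<phi>(2) by (metis minus_minus scaleR_minus_left)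
  have 2: "1/2 * (- ip (lap (t *\<^sub>R \<phi>)) (t *\<^sub>R \<phi>) - \<alpha> * ip (t *\<^sub>R \<phi>) (t *\<^sub>R \<phi>)) = - a * t\<^sup>2"
    by (simp add: laplacian_scaleR lp mu_inner_left mu_inner_right a_def power2_eq_square algebra_simps
      diff_divide_distrib)
  show "J_functional E w \<mu> h \<alpha> \<beta> (t *\<^sub>R \<phi>) \<le> - a * t\<^sup>2 + \<bar>\<beta>\<bar> * (L + t * N)"
    unfolding J_eq 2 using 1 by simp
qed

lemma mean_zero_exists_pos:
  assumes "ip u one = 0" "u \<noteq> 0" obtains x where "u $ x > 0"
proof -
  have "\<exists>x. u $ x > 0"
  proof (rule ccontr)
    assume neg: "\<nexists>x. u $ x > 0"
    have "(\<Sum>x\<in>UNIV. - (\<mu> x * u $ x)) = 0"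
      using assms(1) by (simp add: mu_inner_def vint_def sum_negf)
    then have "\<forall>x. - (\<mu> x * u $ x) = 0"
      using neg mu_pos by (subst (asm) sum_nonneg_eq_0_iff)
        (auto simp: not_less less_imp_le mult_nonneg_nonpos)
    then have "u = 0" using mu_pos by (simp add: vec_eq_iff order_less_imp_not_eq2)
    then show False using assms(2) by simp
  qed
  with that show ?thesis by blast
qed

text \<open>
  On the ray through \<open>\<phi>\<close> the quadratic part is identically zero, and a vertex where \<open>\<phi>\<close> is positive
  forces the logarithm to grow linearly.
\<close>
lemma J_ray_critical:
  assumes h: "\<forall>x. h x > 0" and S: "subspace S" "\<phi> \<in> S" and \<phi>: "\<phi> \<noteq> 0" "- lap \<phi> = l *\<^sub>R \<phi>"
    and mz: "ip \<phi> one = 0" and \<beta>: "\<beta> > 0"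
  shows "(INF u\<in>S. ereal (J_functional E w \<mu> h l \<beta> u)) = -\<infinity>"
proof -
  obtain x where x: "\<phi> $ x > 0" using mean_zero_exists_pos[OF mz \<phi>(1)] .
  define p L where "p = \<phi> $ x" and "L = ln (\<mu> x * h x)"
  have "p > 0" using x by (simp add: p_def)
  have lp: "lap \<phi> = (- l) *\<^sub>R \<phi>" using \<phi>(2) by (metis minus_minus scaleR_minus_left)
  show ?thesis
  proof (rule INF_along_ray[OF S])
    show "filterlim (\<lambda>t. - \<beta> * (L + t * p)) at_bot at_top"
      using \<beta> \<open>p > 0\<close> by real_asymp
    fix t :: real
    have "L + t * p \<le> ln (vint \<mu> (\<lambda>x. h x * exp ((t *\<^sub>R \<phi>) $ x)))"
      using ln_partition_ge[OF h, of x "t *\<^sub>R \<phi>"] by (simp add: L_def p_def)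
    then show "J_functional E w \<mu> h l \<beta> (t *\<^sub>R \<phi>) \<le> - \<beta> * (L + t * p)"
      unfolding J_eq using \<beta>
      by (simp add: laplacian_scaleR lp mu_inner_left mu_inner_right)
  qed
qed

section \<open>Coercivity below a spectral gap\<close>

text \<open>
  The bound at a vertex where \<open>u\<close> is nonnegative; summing absolute values over all vertices makes
  the constant independent of which vertex that is.
\<close>
lemma ln_partition_lower:
  assumes h: "\<forall>x. h x > 0" and mz: "ip u one = 0"
  shows "- (\<Sum>x\<in>UNIV. \<bar>ln (\<mu> x * h x)\<bar>) \<le> ln (vint \<mu> (\<lambda>x. h x * exp (u $ x)))"
proof -
  obtain x where x: "u $ x \<ge> 0"
    using mean_zero_exists_pos[OF mz] by (metis less_imp_le order_refl zero_index)
  have "\<bar>ln (\<mu> x * h x)\<bar> \<le> (\<Sum>x\<in>UNIV. \<bar>ln (\<mu> x * h x)\<bar>)"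
    by (rule member_le_sum) auto
  with x ln_partition_ge[OF h, of x u] show ?thesis by linarith
qed

text \<open>
  The gap \<open>l - \<alpha>\<close> makes the quadratic part coercive on \<open>S\<close>, and for \<open>\<beta> \<le> 0\<close> the logarithmic term
  enters with a nonnegative factor, so that its lower bound on mean-zero functions suffices.
\<close>
lemma J_has_minimizer_on:
  assumes h: "\<forall>x. h x > 0" and S: "subspace S" and mz: "\<And>u. u \<in> S \<Longrightarrow> ip u one = 0"
    and gap: "l > \<alpha>" "\<And>u. u \<in> S \<Longrightarrow> l * ip u u \<le> - ip (lap u) u" and \<beta>: "\<beta> \<le> 0"
  shows "has_minimizer_on (J_functional E w \<mu> h \<alpha> \<beta>) S"
proof -
  obtain c where c: "c > 0" "\<And>u. c * (norm u)\<^sup>2 \<le> ip u u" using mu_inner_self_lower by blast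
  let ?C = "\<Sum>x\<in>UNIV. \<bar>ln (\<mu> x * h x)\<bar>"
  show ?thesis
  proof (rule coercive_has_minimizer_on)
    show "closed S" "S \<noteq> {}" using S by (auto simp: closed_subspace dest: subspace_0)
    show "continuous_on UNIV (J_functional E w \<mu> h \<alpha> \<beta>)" by (rule continuous_J[OF h])
    show "(l - \<alpha>) / 2 * c > 0" using gap c by simp
    fix u assume u: "u \<in> S"
    have "(l - \<alpha>) / 2 * (c * (norm u)\<^sup>2) \<le> (l - \<alpha>) / 2 * ip u u"
      using gap c by (intro mult_left_mono) auto
    also have "\<dots> \<le> 1/2 * (- ip (lap u) u - \<alpha> * ip u u)"
      using gap(2)[OF u] by (simp add: left_diff_distrib diff_divide_distrib)
    finally have 1: "(l - \<alpha>) / 2 * c * (norm u)\<^sup>2 \<le> 1/2 * (- ip (lap u) u - \<alpha> * ip u u)"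
      by (simp add: mult.assoc)
    have "- \<beta> * - ?C \<le> - \<beta> * ln (vint \<mu> (\<lambda>x. h x * exp (u $ x)))"
      using \<beta> ln_partition_lower[OF h mz[OF u]] by (intro mult_left_mono) auto
    with 1 show "(l - \<alpha>) / 2 * c * (norm u)\<^sup>2 - (- \<beta> * ?C) \<le> J_functional E w \<mu> h \<alpha> \<beta> u"
      unfolding J_eq by linarith
  qed
qed

end

theorem theorem2p6:
  fixes E :: "('v::finite \<times> 'v) set"
    and w :: "'v \<Rightarrow> 'v \<Rightarrow> real"
    and \<mu> h :: "'v \<Rightarrow> real"
    and lam :: "nat \<Rightarrow> real"
    and n :: "nat \<Rightarrow> nat"
    and b :: "nat \<Rightarrow> nat \<Rightarrow> real^'v"
    and m k :: nat
  assumes graph: "weighted_graph E w \<mu>"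
    and h_pos: "\<forall>x. h x > 0"
    and lam_increasing: "strict_mono_on {1..m-1} lam"
    and lam_all: "lam ` {1..m-1} = eigenvalues E w \<mu> - {0}"
    and dims: "\<forall>s\<in>{1..m-1}. n s = dim (eigenspace E w \<mu> (lam s))"
    and basis: "\<forall>s\<in>{1..m-1}. orthonormal_basis \<mu> (eigenspace E w \<mu> (lam s)) {1..n s} (b s)"
    and k: "k \<ge> 1" "k + 1 \<le> m - 1"
  shows
    "(\<forall>\<alpha> \<beta>. \<alpha> > lam (k+1) \<longrightarrow>
        (INF u\<in>eigensum_perp E w \<mu> lam k. ereal (J_functional E w \<mu> h \<alpha> \<beta> u)) = -\<infinity>)
   \<and> (\<forall>\<beta>>0.
        (INF u\<in>eigensum_perp E w \<mu> lam k. ereal (J_functional E w \<mu> h (lam (k+1)) \<beta> u)) = -\<infinity>)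
   \<and> (has_minimizer_on (J_functional E w \<mu> h (lam (k+1)) 0) (eigensum_perp E w \<mu> lam k)
      \<and> (\<exists>u\<in>eigensum_perp E w \<mu> lam k. kazdan_warner E w \<mu> h n b k (lam (k+1)) 0 u))
   \<and> (\<forall>\<beta><0.
        has_minimizer_on (J_functional E w \<mu> h (lam (k+1)) \<beta>) (eigensum_perp E w \<mu> lam (k+1))
      \<and> (\<exists>u\<in>eigensum_perp E w \<mu> lam (k+1). kazdan_warner E w \<mu> h n b (k+1) (lam (k+1)) \<beta> u))"
proof -
  interpret finite_weighted_graph E w \<mu> by unfold_locales (rule graph)
  let ?l = "lam (k+1)"
  have k1: "k + 1 \<in> {1..m-1}" using k by auto
  have mono: "lam s < lam t" if "s \<in> {1..m-1}" "t \<in> {1..m-1}" "s < t" for s t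
    using strict_mono_onD[OF lam_increasing that] .
  have nz: "lam s \<noteq> 0" if "s \<in> {1..m-1}" for s
    using that lam_all by blast
  have inj: "inj_on lam {1..j}" if "j \<le> m - 1" for j
    using strict_mono_on_imp_inj_on[OF lam_increasing] by (rule inj_on_subset) (use that in auto)
  have "?l \<in> eigenvalues E w \<mu>" using lam_all k1 by blast
  then obtain \<phi> where \<phi>: "\<phi> \<noteq> 0" "- lap \<phi> = ?l *\<^sub>R \<phi>" by (auto simp: eigenvalues_def)
  have \<phi>S: "\<phi> \<in> perp lam k"
    by (rule eigenvector_in_perp[OF \<phi>(2)]) (use nz k1 mono[OF _ k1] in force)+
  have kw: "\<exists>u\<in>perp lam j. kazdan_warner E w \<mu> h n b j ?l \<beta> u"
    if j: "j \<le> m - 1" and m: "has_minimizer_on (J_functional E w \<mu> h ?l \<beta>) (perp lam j)" for j \<beta>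
  proof -
    obtain u where u: "u \<in> perp lam j"
      "\<And>v. v \<in> perp lam j \<Longrightarrow> J_functional E w \<mu> h ?l \<beta> u \<le> J_functional E w \<mu> h ?l \<beta> v"
      using m by (auto simp: has_minimizer_on_def)
    have "kazdan_warner E w \<mu> h n b j ?l \<beta> u"
      by (rule kazdan_warner_of_minimizer[OF h_pos _ inj[OF j] _ u]) (use basis nz j in auto)
    with u show ?thesis by blast
  qed
  have min0: "has_minimizer_on (J_functional E w \<mu> h ?l 0) (perp lam k)"
    unfolding has_minimizer_on_def
  proof (intro bexI ballI)
    \<comment> \<open>The form is nonnegative on \<open>E\<^sub>k\<^sup>\<bottom>\<close> and vanishes at \<open>0\<close>.\<close>
    show "0 \<in> perp lam k" by (rule subspace_0[OF subspace_perp])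
    fix v assume v: "v \<in> perp lam k"
    have "perp lam k \<noteq> {0}" using \<phi>S \<phi> by blast
    then obtain s where s: "s \<in> {k+1..m-1}"
      "\<And>u. u \<in> perp lam k \<Longrightarrow> lam s * ip u u \<le> - ip (lap u) u"
      using perp_spectral_gap[OF lam_all] by metis
    have "?l \<le> lam s" using s(1) mono[OF k1, of s] by (cases "s = k + 1") auto
    then have "?l * ip v v \<le> lam s * ip v v" by (rule mult_right_mono[OF _ mu_inner_self_nonneg])
    also have "\<dots> \<le> - ip (lap v) v" by (rule s(2)[OF v])
    finally show "J_functional E w \<mu> h ?l 0 0 \<le> J_functional E w \<mu> h ?l 0 v"
      by (simp add: J_eq mu_inner_zero_left)
  qed
  have min1: "has_minimizer_on (J_functional E w \<mu> h ?l \<beta>) (perp lam (k+1))" if "\<beta> < 0" for \<beta>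
  proof (cases "perp lam (k+1) = {0}")
    \<comment> \<open>This occurs when \<open>lam (k+1)\<close> is the largest eigenvalue.\<close>
    case True
    then show ?thesis by (simp add: has_minimizer_on_def)
  next
    case False
    then obtain s where s: "s \<in> {k+1+1..m-1}"
      "\<And>u. u \<in> perp lam (k+1) \<Longrightarrow> lam s * ip u u \<le> - ip (lap u) u"
      using perp_spectral_gap[OF lam_all] by metis
    have "?l < lam s" using s(1) mono[OF k1, of s] by auto
    then show ?thesis
      using J_has_minimizer_on[OF h_pos subspace_perp _ _ s(2)] that
      by (simp add: eigensum_perp_iff less_imp_le)
  qed
  have mzphi: "ip \<phi> one = 0" by (rule eigenvector_mean_zero[OF \<phi>(2) nz[OF k1]])
  show ?thesis
  proof (intro conjI allI impI)
    fix \<alpha> \<beta> :: real assume "\<alpha> > ?l"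
    then show "(INF u\<in>perp lam k. ereal (J_functional E w \<mu> h \<alpha> \<beta> u)) = -\<infinity>"
      by (rule J_ray_supercritical[OF h_pos subspace_perp \<phi>S \<phi>])
  next
    fix \<beta> :: real assume "\<beta> > 0"
    then show "(INF u\<in>perp lam k. ereal (J_functional E w \<mu> h ?l \<beta> u)) = -\<infinity>"
      by (rule J_ray_critical[OF h_pos subspace_perp \<phi>S \<phi> mzphi])
  next
    show "has_minimizer_on (J_functional E w \<mu> h ?l 0) (perp lam k)" by (rule min0)
    show "\<exists>u\<in>perp lam k. kazdan_warner E w \<mu> h n b k ?l 0 u"
      by (rule kw[OF _ min0]) (use k in simp)
  next
    fix \<beta> :: real assume \<beta>: "\<beta> < 0"
    show "has_minimizer_on (J_functional E w \<mu> h ?l \<beta>) (perp lam (k+1))" by (rule min1[OF \<beta>])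
    show "\<exists>u\<in>perp lam (k+1). kazdan_warner E w \<mu> h n b (k+1) ?l \<beta> u"
      by (rule kw[OF k(2) min1[OF \<beta>]])
  qed
qed

end
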